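(* In the two-slope ski rental problem with tail constraint $(\gamma,\delta)$ described in the context, let $f$ be an optimal solution such that $\alpha_f$ is strictly decreasing on every zero interval of $f$ contained in $[1,\infty)$. Then $f$ places exactly $\delta$ mass on $(L_b,\infty]$, where $L_b=\frac{\gamma-1}{1-a\gamma}$.
   Context: Fix $0\le a<1$ and $(\gamma,\delta)$ with $2-a\le\gamma<1/a$, $0\le\delta\le1$. A purchase distribution $f$ is a probability distribution on $[0,\infty)\cup\{\infty\}$ (buying time; $\infty$ = never buy). For buying time $t$ and stopping time $x>0$: $\alpha(t,x)=\frac{t+1-a+a(x-t)}{x}$ if $t\le x\le1$; $1$ if $t>x$, $x\le1$; $\frac{t+1-a+a(x-t)}{1-a+ax}$ if $t\le x$, $x>1$; $\frac{x}{1-a+ax}$ if $t>x$, $x>1$ (incl. $t=\infty$); $\alpha(t,\infty)=1$ for finite $t$, $\alpha(\infty,\infty)=1/a$. $\alpha_f(x)=\mathbb{E}_{t\sim f}\alpha(t,x)$. Bad interval $I_\gamma(x)=\{t:\alpha(t,x)>\gamma\}$; $f$ feasible if $f(I_\gamma(x))\le\delta$ for all $x\in(0,\infty]$. $\mathrm{OPT}=\min_{f\text{ feasible}}\sup_x\alpha_f(x)$; an optimal solution is a feasible $f$ attaining it. A zero interval of $f$ is an interval $[T_1,T_2]$ with $T_1<T_2<\infty$ carrying no mass of $f$. *)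

theory Defs
  imports "HOL-Probability.Probability"
begin

text \<open>
  Times range over \<^typ>\<open>ennreal\<close>, i.e. over $[0,\infty) \cup \{\infty\}$. Competitive ratios are
  \<^typ>\<open>ennreal\<close>-valued too, because for $a = 0$ the ratio $1/a$ of never buying against an infinite
  stopping time is $\infty$; note \<^term>\<open>1 / (0::ennreal) = \<infinity>\<close>. The real formulas below are
  nonnegative for $0 \le a < 1$, so \<^const>\<open>ennreal\<close> does not truncate them. The value at stopping
  time $0$ is a dummy.
\<close>

definition ratio :: "real \<Rightarrow> ennreal \<Rightarrow> ennreal \<Rightarrow> ennreal" where
  "ratio a t x =
     (if x = \<infinity> then (if t = \<infinity> then 1 / ennreal a else 1)
      else (let s = enn2real t; y = enn2real x in
        if x \<le> 1 then
          (if t \<le> x then ennreal ((s + 1 - a + a * (y - s)) / y) else 1)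
        else
          (if t \<le> x then ennreal ((s + 1 - a + a * (y - s)) / (1 - a + a * y))
           else ennreal (y / (1 - a + a * y)))))"

definition purchase_distribution :: "ennreal measure \<Rightarrow> bool" where
  "purchase_distribution f \<longleftrightarrow> prob_space f \<and> sets f = sets borel"

definition expected_ratio :: "real \<Rightarrow> ennreal measure \<Rightarrow> ennreal \<Rightarrow> ennreal" where
  "expected_ratio a f x = (\<integral>\<^sup>+ t. ratio a t x \<partial>f)"

definition bad_interval :: "real \<Rightarrow> real \<Rightarrow> ennreal \<Rightarrow> ennreal set" where
  "bad_interval a \<gamma> x = {t. ratio a t x > ennreal \<gamma>}"

definition feasible :: "real \<Rightarrow> real \<Rightarrow> real \<Rightarrow> ennreal measure \<Rightarrow> bool" where
  "feasible a \<gamma> \<delta> f \<longleftrightarrow>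
     purchase_distribution f \<and> (\<forall>x>0. measure f (bad_interval a \<gamma> x) \<le> \<delta>)"

definition worst_ratio :: "real \<Rightarrow> ennreal measure \<Rightarrow> ennreal" where
  "worst_ratio a f = (SUP x\<in>{0<..}. expected_ratio a f x)"

definition OPT :: "real \<Rightarrow> real \<Rightarrow> real \<Rightarrow> ennreal" where
  "OPT a \<gamma> \<delta> = (INF f\<in>{f. feasible a \<gamma> \<delta> f}. worst_ratio a f)"

definition optimal_solution :: "real \<Rightarrow> real \<Rightarrow> real \<Rightarrow> ennreal measure \<Rightarrow> bool" where
  "optimal_solution a \<gamma> \<delta> f \<longleftrightarrow> feasible a \<gamma> \<delta> f \<and> worst_ratio a f = OPT a \<gamma> \<delta>"

definition zero_interval :: "ennreal measure \<Rightarrow> ennreal \<Rightarrow> ennreal \<Rightarrow> bool" where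
  "zero_interval f T1 T2 \<longleftrightarrow> T1 < T2 \<and> T2 < \<infinity> \<and> measure f {T1..T2} = 0"

definition L_b :: "real \<Rightarrow> real \<Rightarrow> real" where
  "L_b a \<gamma> = (\<gamma> - 1) / (1 - a * \<gamma>)"

end

theory Submission
  imports Defs
begin

text \<open>
  Suppose that less than \<open>\<delta>\<close> mass lies beyond \<open>L_b\<close>. Then a little mass may be moved from
  anywhere to a far point \<open>y > L_b + 1\<close> without losing feasibility: the bad intervals of stopping
  times up to \<open>L_b + 1\<close> do not contain \<open>y\<close>, and those of later stopping times lie beyond \<open>L_b\<close>.
  Moving mass from \<open>t\<close> lowers the ratio at \<open>x\<close> if \<open>x < t + 1\<close> but raises it if \<open>x > t + 1\<close>, so the
  weights with which mass is removed must be increasing in \<open>t\<close>, in one of two ways.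

  Let \<open>F\<close> be the distribution function of \<open>f\<close> and \<open>c = OPT\<close>. If \<open>(1 - a) F x > 1 - c a\<close>
  for some \<open>x \<ge> 1\<close>, the ratio stays below \<open>c\<close> from some \<open>T\<close> on. Removing mass with weights
  \<open>exp (b t)\<close> on \<open>[0, T]\<close> for large \<open>b\<close> then lowers the ratio at all nearly tight \<open>x \<le> T\<close>,
  because by the assumption on zero intervals there is mass just to the left of such \<open>x\<close>. Otherwise
  the assumption gives \<open>(1 - a) F x < 1 - c a\<close> for all \<open>x \<ge> 1\<close>, so that the ratio is bounded away
  from \<open>c\<close> on bounded subsets of \<open>[1, \<infinity>)\<close>, and there is mass right beyond \<open>y\<close>. Here the weights
  \<open>1\<close> before and a large \<open>W\<close> after \<open>y\<close> work. In both cases \<open>f\<close> is not optimal.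
\<close>

section \<open>Costs and ratios as real-valued functions\<close>

definition opt_cost :: "real \<Rightarrow> real \<Rightarrow> real" where
  "opt_cost a x = min x (1 - a + a * x)"

text \<open>Buying at \<open>t \<le> x\<close> costs \<open>x + (1 - a) * (1 - x + t)\<close>,
  renting up to \<open>x\<close> costs \<open>x\<close>. The excess is the surcharge over renting in
  units of \<open>1 - a\<close>; it changes sign at \<open>t = x - 1\<close>.\<close>

definition excess :: "real \<Rightarrow> ennreal \<Rightarrow> real" where
  "excess x t = (if t \<le> ennreal x then 1 - x + enn2real t else 0)"

definition real_ratio :: "real \<Rightarrow> real \<Rightarrow> ennreal \<Rightarrow> real" where
  "real_ratio a x t = (x + (1 - a) * excess x t) / opt_cost a x"

lemma opt_cost_le_1: "x \<le> 1 \<Longrightarrow> a < 1 \<Longrightarrow> opt_cost a x = x"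
proof -
  assume "x \<le> 1" "a < 1"
  then have "0 \<le> (1 - a) * (1 - x)" by simp
  then show ?thesis by (simp add: opt_cost_def algebra_simps)
qed

lemma opt_cost_ge_1: "1 \<le> x \<Longrightarrow> a < 1 \<Longrightarrow> opt_cost a x = 1 - a + a * x"
proof -
  assume "1 \<le> x" "a < 1"
  then have "0 \<le> (1 - a) * (x - 1)" by simp
  then show ?thesis by (simp add: opt_cost_def algebra_simps)
qed

lemma opt_cost_pos: "0 < x \<Longrightarrow> 0 \<le> a \<Longrightarrow> a < 1 \<Longrightarrow> 0 < opt_cost a x"
  by (simp add: opt_cost_def add_pos_nonneg)

lemma opt_cost_le: "opt_cost a x \<le> x"
  by (simp add: opt_cost_def)

lemma one_le_opt_cost: "1 \<le> x \<Longrightarrow> 0 \<le> a \<Longrightarrow> a < 1 \<Longrightarrow> 1 \<le> opt_cost a x"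
  using mult_left_mono[of 1 x a] by (simp add: opt_cost_ge_1)

lemma enn2real_le: "t \<le> ennreal x \<Longrightarrow> 0 \<le> x \<Longrightarrow> enn2real t \<le> x"
  by (metis enn2real_leI)

lemma ennreal_le_cases:
  assumes "0 < x"
  obtains (le) s where "t = ennreal s" "0 \<le> s" "s \<le> x" | (gt) "ennreal x < t"
proof (cases "t \<le> ennreal x")
  case True
  then have "t < \<infinity>" by (metis ennreal_less_top infinity_ennreal_def le_less_trans)
  then show ?thesis using True assms le[of "enn2real t"] enn2real_le[of t x] by simp
qed (use gt in auto)

lemma excess_le [simp]: "0 \<le> s \<Longrightarrow> s \<le> x \<Longrightarrow> excess x (ennreal s) = 1 - x + s"
  by (simp add: excess_def ennreal_leI)

lemma excess_gt [simp]: "ennreal x < t \<Longrightarrow> excess x t = 0"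
  by (simp add: excess_def)

lemma real_ratio_ge_1:
  assumes "0 \<le> a" "a < 1" "0 < x"
  shows "1 \<le> real_ratio a x t"
proof -
  have "opt_cost a x \<le> x + (1 - a) * excess x t"
    using assms(3)
  proof (cases rule: ennreal_le_cases[of x t])
    case (le s)
    then have "0 \<le> (1 - a) * s" using assms by simp
    then have "1 - a + a * x \<le> x + (1 - a) * excess x t"
      using le by (simp add: algebra_simps)
    then show ?thesis by (simp add: opt_cost_def)
  qed (simp add: opt_cost_le)
  then show ?thesis using opt_cost_pos[of x a] assms by (simp add: real_ratio_def)
qed

lemma ratio_eq_real_ratio:
  assumes "0 \<le> a" "a < 1" "0 < x"
  shows "ratio a t (ennreal x) = ennreal (real_ratio a x t)"
  using assms(3)
proof (cases rule: ennreal_le_cases[of x t])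
  case (le s)
  then have "s + 1 - a + a * (x - s) = x + (1 - a) * (1 - x + s)"
    by (simp add: algebra_simps)
  with le assms show ?thesis
    by (auto simp: ratio_def real_ratio_def Let_def opt_cost_le_1 opt_cost_ge_1 ennreal_leI ennreal_le_1)
next
  case gt
  with assms show ?thesis
    by (auto simp: ratio_def real_ratio_def Let_def opt_cost_le_1 opt_cost_ge_1 ennreal_le_1)
qed

lemma excess_measurable [measurable]: "excess x \<in> borel_measurable borel"
  unfolding excess_def by measurable

lemma excess_bounds:
  assumes "0 < x"
  shows "- x \<le> excess x t" "excess x t \<le> 1"
  using assms by (cases rule: ennreal_le_cases[of x t]; simp)+

lemma abs_excess_le: "0 < x \<Longrightarrow> \<bar>excess x t\<bar> \<le> 1 + x"
  using excess_bounds[of x t] by linarith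

lemma real_ratio_measurable [measurable]: "real_ratio a x \<in> borel_measurable borel"
  unfolding real_ratio_def by measurable

lemma ratio_measurable:
  assumes "0 \<le> a" "a < 1" "0 < x"
  shows "(\<lambda>t. ratio a t (ennreal x)) \<in> borel_measurable borel"
  using assms by (simp add: ratio_eq_real_ratio)

text \<open>The bound is uniform in \<open>x\<close>: it caps the harm that mass moved to
  \<open>y\<close> can do at any stopping time.\<close>

lemma real_ratio_le:
  assumes "0 \<le> a" "a < 1" "1 \<le> y" "0 < x"
  shows "real_ratio a x (ennreal y) \<le> 1 + y"
proof (cases "y \<le> x")
  case True
  have "0 \<le> a * (x - 1)" "0 \<le> y * a * x" using assms True by auto
  moreover have "x + (1 - a) * (1 - x + y) = opt_cost a x + (1 - a) * y"
    using assms True by (simp add: opt_cost_ge_1 algebra_simps)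
  moreover have "(1 - a) * y \<le> y * opt_cost a x"
    using assms True one_le_opt_cost[of x a] mult_mono[of "1 - a" 1 y y] mult_left_mono[of 1 "opt_cost a x" y]
    by simp
  ultimately show ?thesis using assms True opt_cost_pos[of x a]
    by (simp add: real_ratio_def divide_simps algebra_simps)
next
  case False
  then have [simp]: "excess x (ennreal y) = 0" using assms by (simp add: ennreal_lessI)
  show ?thesis
  proof (cases "x \<le> 1")
    case True then show ?thesis using assms by (simp add: real_ratio_def opt_cost_le_1)
  next
    case xg: False
    have "x / opt_cost a x \<le> x / 1"
      using one_le_opt_cost[of x a] assms xg by (intro divide_left_mono) auto
    then show ?thesis using False by (simp add: real_ratio_def)
  qed
qed

section \<open>Moving mass to a single point\<close>

text \<open>A share \<open>u t\<close> of the mass at \<open>t\<close> is sent to \<open>y\<close>.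
  The measure is an image of the product of \<open>f\<close> with two outcomes, weighted by
  \<open>p\<close>, so that integrals against it reduce to integrals against
  \<open>f\<close>.\<close>

lemma displaced_measure_exists:
  fixes f :: "'a::second_countable_topology measure" and y :: 'a
  assumes "prob_space f" and sets_f [measurable_cong, simp]: "sets f = sets borel"
    and u [measurable]: "u \<in> borel_measurable borel"
    and u_bounds: "\<And>t. 0 \<le> u t" "\<And>t. u t \<le> (1::real)"
  obtains g where "prob_space g" "sets g = sets borel"
    "\<And>h. h \<in> borel_measurable borel \<Longrightarrow>
      (\<integral>\<^sup>+ t. h t \<partial>g) = (\<integral>\<^sup>+ t. ennreal (1 - u t) * h t + ennreal (u t) * h y \<partial>f)"
proof -
  define C where "C = count_space (UNIV :: bool set)"
  define p where "p = (\<lambda>(t::'a, b::bool). ennreal (if b then u t else 1 - u t))"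
  define k where "k = (\<lambda>(t::'a, b::bool). if b then y else t)"
  interpret C: sigma_finite_measure C
    unfolding C_def by (rule sigma_finite_measure_count_space_finite) simp
  have [measurable_cong]: "sets C = sets (count_space UNIV)" by (simp add: C_def)
  have p [measurable]: "p \<in> borel_measurable (f \<Otimes>\<^sub>M C)" unfolding p_def by measurable
  have k [measurable]: "k \<in> f \<Otimes>\<^sub>M C \<rightarrow>\<^sub>M borel" unfolding k_def by measurable
  define g where "g = distr (density (f \<Otimes>\<^sub>M C) p) borel k"
  have integral: "(\<integral>\<^sup>+ t. h t \<partial>g) = (\<integral>\<^sup>+ t. ennreal (1 - u t) * h t + ennreal (u t) * h y \<partial>f)"
    if h [measurable]: "h \<in> borel_measurable borel" for h
  proof -
    have "(\<integral>\<^sup>+ t. h t \<partial>g) = (\<integral>\<^sup>+ z. p z * h (k z) \<partial>(f \<Otimes>\<^sub>M C))"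
      unfolding g_def by (subst nn_integral_distr) (auto simp: nn_integral_density)
    also have "\<dots> = (\<integral>\<^sup>+ t. \<integral>\<^sup>+ b. p (t, b) * h (k (t, b)) \<partial>C \<partial>f)"
      by (subst C.nn_integral_fst[symmetric]) simp_all
    also have "\<dots> = (\<integral>\<^sup>+ t. ennreal (1 - u t) * h t + ennreal (u t) * h y \<partial>f)"
      by (simp add: C_def nn_integral_count_space_finite p_def k_def UNIV_bool)
    finally show ?thesis .
  qed
  have "emeasure g (space g) = (\<integral>\<^sup>+ t. 1 \<partial>g)" by simp
  also have "\<dots> = (\<integral>\<^sup>+ t. ennreal (1 - u t) + ennreal (u t) \<partial>f)"
    by (subst integral) auto
  also have "\<dots> = (\<integral>\<^sup>+ t. 1 \<partial>f)"
    using u_bounds by (simp flip: ennreal_plus)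
  also have "\<dots> = 1" using assms(1) by (simp add: prob_space.emeasure_space_1)
  finally have "prob_space g" by (rule prob_spaceI)
  moreover have "sets g = sets borel" by (simp add: g_def)
  ultimately show ?thesis using that integral by blast
qed

section \<open>Expected excess and expected ratio of a purchase distribution\<close>

locale two_slope =
  fixes a :: real and f :: "ennreal measure"
  assumes a_nonneg: "0 \<le> a" and a_less_1: "a < 1"
    and purchase_distribution: "purchase_distribution f"
begin

sublocale prob_space f
  using purchase_distribution by (simp add: purchase_distribution_def)

lemma sets_f [measurable_cong, simp]: "sets f = sets borel"
  using purchase_distribution by (simp add: purchase_distribution_def)

lemma space_f [simp]: "space f = UNIV"
  using sets_eq_imp_space_eq[OF sets_f] by simp

lemma prob_UNIV [simp]: "prob UNIV = 1"
  using prob_space by simp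

definition mean_excess :: "real \<Rightarrow> real" where
  "mean_excess x = (LINT t|f. excess x t)"

definition mean_ratio :: "real \<Rightarrow> real" where
  "mean_ratio x = (x + (1 - a) * mean_excess x) / opt_cost a x"

abbreviation F :: "real \<Rightarrow> real" where
  "F x \<equiv> prob {..ennreal x}"

lemma integrable_bounded:
  assumes "h \<in> borel_measurable borel" "\<And>t. \<bar>h t\<bar> \<le> (B::real)"
  shows "integrable f h"
  using assms by (intro integrable_const_bound[of _ B]) (auto cong: measurable_cong_sets)

lemma integrable_indicat [simp]: "A \<in> sets borel \<Longrightarrow> integrable f (indicat_real A)"
  by (rule integrable_bounded[of _ 1]) (auto simp: indicator_def)

lemma integrable_excess [simp]: "0 < x \<Longrightarrow> integrable f (excess x)"
  by (rule integrable_bounded[OF _ abs_excess_le]) auto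

lemma integrable_real_ratio [simp]: "0 < x \<Longrightarrow> integrable f (real_ratio a x)"
  unfolding real_ratio_def by simp

lemma mean_ratio_eq: "0 < x \<Longrightarrow> mean_ratio x = (LINT t|f. real_ratio a x t)"
  by (simp add: mean_ratio_def mean_excess_def real_ratio_def)

lemma expected_ratio_eq:
  assumes "0 < x"
  shows "expected_ratio a f (ennreal x) = ennreal (mean_ratio x)"
proof -
  have "0 \<le> real_ratio a x t" for t
    using real_ratio_ge_1[of a x t] a_nonneg a_less_1 assms by linarith
  then show ?thesis
    using assms unfolding expected_ratio_def
    by (simp add: ratio_eq_real_ratio[OF a_nonneg a_less_1] mean_ratio_eq nn_integral_eq_integral)
qed

text \<open>From \<open>x\<close> to \<open>y\<close>, the excess of a purchase made by
  \<open>x\<close> falls by \<open>y - x\<close>, that of a purchase in between changes by at least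
  \<open>-(y - x)\<close> and at most \<open>1\<close>, and that of a later one stays
  \<open>0\<close>.\<close>

lemma mean_excess_diff:
  assumes "0 < x" "x \<le> y"
  shows "mean_excess y - mean_excess x \<le> prob {ennreal x<..ennreal y} - (y - x) * F x"
    and "- (y - x) * F y \<le> mean_excess y - mean_excess x"
proof -
  have diff: "mean_excess y - mean_excess x = (LINT t|f. excess y t - excess x t)"
    using assms by (simp add: mean_excess_def)
  have "excess y t - excess x t
      \<le> indicator {ennreal x<..ennreal y} t - (y - x) * indicator {..ennreal x} t
      \<and> - (y - x) * indicator {..ennreal y} t \<le> excess y t - excess x t" for t
  proof -
    have "0 < y" using assms by simp
    then show ?thesis
    proof (cases rule: ennreal_le_cases[of y t])
      case (le s)
      then show ?thesis
        using assms by (cases "s \<le> x") (auto simp: excess_def ennreal_less_iff)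
    next
      case gt
      moreover have "ennreal x < t"
        using gt assms(2) by (meson ennreal_leI le_less_trans)
      ultimately show ?thesis using assms by (simp add: leD)
    qed
  qed
  then have "(LINT t|f. excess y t - excess x t)
      \<le> (LINT t|f. indicator {ennreal x<..ennreal y} t - (y - x) * indicator {..ennreal x} t)"
    "(LINT t|f. - (y - x) * indicator {..ennreal y} t) \<le> (LINT t|f. excess y t - excess x t)"
    using assms by (intro integral_mono Bochner_Integration.integrable_diff integrable_mult_right; simp)+
  then show "mean_excess y - mean_excess x \<le> prob {ennreal x<..ennreal y} - (y - x) * F x"
    "- (y - x) * F y \<le> mean_excess y - mean_excess x"
    unfolding diff using assms by (simp_all add: integral_diff)
qed

lemma mean_ratio_ge_1: "0 < x \<Longrightarrow> 1 \<le> mean_ratio x"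
  using integral_mono[of f "\<lambda>_. 1" "real_ratio a x"] real_ratio_ge_1[OF a_nonneg a_less_1]
  by (simp add: mean_ratio_eq)

lemma F_diff: "x \<le> y \<Longrightarrow> F y = F x + prob {ennreal x<..ennreal y}"
  by (subst finite_measure_Union[symmetric]) (auto simp: ennreal_leI ivl_disj_un)

end

text \<open>By Fatou's lemma, the infinite stopping time needs no separate treatment.\<close>

lemma ratio_infinity_le_liminf:
  assumes "0 \<le> a" "a < 1"
  shows "ratio a t \<infinity> \<le> liminf (\<lambda>n. ratio a t (ennreal (real (Suc n))))"
proof (cases "t = \<infinity>")
  case True
  have "(\<lambda>n. ennreal (real_ratio a (real (Suc n)) \<infinity>)) \<longlonglongrightarrow> 1 / ennreal a"
  proof (cases "a = 0")
    case True
    then have "(\<lambda>n. ennreal (real_ratio a (real (Suc n)) \<infinity>)) = (\<lambda>n. of_nat (Suc n))"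
      by (simp add: real_ratio_def opt_cost_def ennreal_of_nat_eq_real_of_nat)
    then show ?thesis using True
      by (simp add: LIMSEQ_Suc of_nat_tendsto_top_ennreal ennreal_divide_zero del: of_nat_Suc)
  next
    case False
    then have "(\<lambda>n. real (Suc n) / (1 - a + a * real (Suc n))) \<longlonglongrightarrow> inverse a"
      using assms by real_asymp
    then have "(\<lambda>n. real_ratio a (real (Suc n)) \<infinity>) \<longlonglongrightarrow> 1 / a"
      using assms by (simp add: real_ratio_def opt_cost_ge_1 inverse_eq_divide)
    moreover have "ennreal (1 / a) = 1 / ennreal a"
      using False assms divide_ennreal[of 1 a, symmetric] unfolding ennreal_1 by linarith
    ultimately show ?thesis using tendsto_ennrealI by metis
  qed
  then have "liminf (\<lambda>n. ennreal (real_ratio a (real (Suc n)) \<infinity>)) = 1 / ennreal a"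
    by (intro lim_imp_Liminf) auto
  moreover have "ratio a t (ennreal (real (Suc n))) = ennreal (real_ratio a (real (Suc n)) \<infinity>)" for n
    using True assms ratio_eq_real_ratio[of a "real (Suc n)" t] by simp
  moreover have "ratio a t \<infinity> = 1 / ennreal a" using True by (simp add: ratio_def)
  ultimately show ?thesis by simp
next
  case False
  \<comment> \<open>A finite buying time has ratio \<open>1\<close> against the infinite stopping
    time, and no ratio is below \<open>1\<close>.\<close>
  have "1 \<le> ratio a t (ennreal (real (Suc n)))" for n
    using assms real_ratio_ge_1[of a "real (Suc n)" t] by (simp add: ratio_eq_real_ratio del: of_nat_Suc)
  then show ?thesis using False by (auto simp: ratio_def intro!: Liminf_bounded)
qed

context two_slope
begin

lemma worst_ratio_le:
  assumes "\<And>x. 0 < x \<Longrightarrow> mean_ratio x \<le> C"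
  shows "worst_ratio a f \<le> ennreal C"
proof -
  have le: "expected_ratio a f (ennreal x) \<le> ennreal C" if "0 < x" for x
    using assms that by (simp add: expected_ratio_eq ennreal_leI)
  have [measurable]: "(\<lambda>t. ratio a t (ennreal (real (Suc n)))) \<in> borel_measurable f" for n
    using ratio_measurable[OF a_nonneg a_less_1, of "real (Suc n)"] by simp
  have "expected_ratio a f \<infinity> \<le> (\<integral>\<^sup>+ t. liminf (\<lambda>n. ratio a t (ennreal (real (Suc n)))) \<partial>f)"
    unfolding expected_ratio_def
    by (intro nn_integral_mono ratio_infinity_le_liminf a_nonneg a_less_1)
  also have "\<dots> \<le> liminf (\<lambda>n. expected_ratio a f (ennreal (real (Suc n))))"
    unfolding expected_ratio_def by (rule nn_integral_liminf) fact
  also have "\<dots> \<le> ennreal C"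
  proof (intro Liminf_le always_eventually allI)
    show "expected_ratio a f (ennreal (real (Suc n))) \<le> ennreal C" for n by (rule le) simp
  qed simp
  finally have inf: "expected_ratio a f \<infinity> \<le> ennreal C" .
  show ?thesis
    unfolding worst_ratio_def
  proof (rule SUP_least)
    fix x :: ennreal assume "x \<in> {0<..}"
    then show "expected_ratio a f x \<le> ennreal C"
      using le inf by (cases x) auto
  qed
qed

end

section \<open>Slack below the optimal value and its growth\<close>

text \<open>Here \<open>c\<close> stands for the optimal value, and the second assumption is the one
  on zero intervals in terms of real numbers. The tail constraint enters only later.\<close>

locale steep_solution = two_slope +
  fixes c :: real
  assumes mean_ratio_le: "0 < x \<Longrightarrow> mean_ratio x \<le> c"
    and mean_ratio_steep:
      "1 \<le> u \<Longrightarrow> u < v \<Longrightarrow> prob {ennreal u..ennreal v} = 0 \<Longrightarrow> mean_ratio v < mean_ratio u"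
begin

text \<open>On a zero interval in \<open>[1, \<infinity>)\<close> the function \<open>gap\<close> is affine with slope \<open>rate\<close>.\<close>

definition gap :: "real \<Rightarrow> real" where
  "gap x = c * opt_cost a x - x - (1 - a) * mean_excess x"

definition rate :: "real \<Rightarrow> real" where
  "rate x = (1 - a) * F x - (1 - c * a)"

text \<open>The function \<open>gap\<close> is the slack below \<open>c\<close> cleared of its
  denominator; tight stopping times are its zeros.\<close>

lemma mean_ratio_gap: "0 < x \<Longrightarrow> mean_ratio x = c - gap x / opt_cost a x"
  using opt_cost_pos[OF _ a_nonneg a_less_1, of x]
  by (simp add: mean_ratio_def gap_def diff_divide_distrib add_divide_distrib)

lemma gap_nonneg: "0 < x \<Longrightarrow> 0 \<le> gap x"
  using mean_ratio_le[of x] opt_cost_pos[OF _ a_nonneg a_less_1, of x]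
  by (simp add: mean_ratio_gap zero_le_divide_iff)

lemma mean_ratio_le_if_gap_ge:
  assumes "0 < x" "x \<le> T" "s \<le> gap x"  "0 \<le> s"
  shows "mean_ratio x \<le> c - s / T"
proof -
  have "s / T \<le> gap x / opt_cost a x"
    using assms opt_cost_le[of a x] opt_cost_pos[OF _ a_nonneg a_less_1, of x]
    by (intro frac_le) auto
  then show ?thesis using assms by (simp add: mean_ratio_gap)
qed

text \<open>No distribution has ratio \<open>1\<close> at both \<open>1/2\<close> and
  \<open>2\<close>: the mean excesses there would be at most \<open>0\<close> and \<open>-1\<close>,
  while the two excesses add up to at least \<open>-1/2\<close> at every point.\<close>

lemma c_gt_1: "1 < c"
proof (rule ccontr)
  assume "\<not> 1 < c"
  then have "mean_ratio 2 \<le> 1" "mean_ratio (1/2) \<le> 1"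
    using mean_ratio_le[of 2] mean_ratio_le[of "1/2"] by auto
  then have "(1 - a) * (mean_excess 2 + 1) \<le> 0" "(1 - a) * mean_excess (1/2) \<le> 0"
    using a_nonneg a_less_1
    by (auto simp: mean_ratio_def opt_cost_ge_1 opt_cost_le_1 field_simps)
  then have "mean_excess 2 \<le> - 1" "mean_excess (1/2) \<le> 0"
    using a_less_1 by (auto simp: mult_le_0_iff)
  moreover have "- (1/2) \<le> excess 2 t + excess (1/2) t" for t
  proof -
    have "(0::real) < 2" by simp
    then show ?thesis
    proof (cases rule: ennreal_le_cases[of 2 t])
      case (le s)
      have "excess (1/2) (ennreal s) = 0" if "1/2 < s"
        by (rule excess_gt, rule ennreal_lessI) (use that in auto)
      then show ?thesis
        using le by (cases "s \<le> 1/2") simp_all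
    next
      case gt
      moreover have "ennreal (1/2) < ennreal 2" by (rule ennreal_lessI) auto
      ultimately have "ennreal (1/2) < t" by (rule less_trans[rotated])
      then show ?thesis using gt by (simp only: excess_gt)
    qed
  qed
  then have "(LINT t|f. - (1/2)) \<le> (LINT t|f. excess 2 t + excess (1/2) t)"
    by (intro integral_mono) auto
  ultimately show False by (simp add: mean_excess_def)
qed

text \<open>From \<open>1\<close> on \<open>opt_cost\<close> is affine with slope \<open>a\<close>,
  so the bounds of \<open>mean_excess_diff\<close> carry over.\<close>

lemma gap_diff:
  assumes "1 \<le> x" "x \<le> y"
  shows "gap y - gap x \<le> (y - x) * rate y"
    and "(y - x) * rate x - prob {ennreal x<..ennreal y} \<le> gap y - gap x"
proof -
  have eq: "gap y - gap x = (y - x) * (c * a - 1) - (1 - a) * (mean_excess y - mean_excess x)"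
    using assms a_less_1 by (simp add: gap_def opt_cost_ge_1 algebra_simps)
  have "(1 - a) * (- (y - x) * F y) \<le> (1 - a) * (mean_excess y - mean_excess x)"
    using mean_excess_diff(2)[of x y] assms a_less_1 by (intro mult_left_mono) auto
  then show "gap y - gap x \<le> (y - x) * rate y"
    unfolding eq by (simp add: rate_def algebra_simps)
  have "(1 - a) * (mean_excess y - mean_excess x)
      \<le> (1 - a) * (prob {ennreal x<..ennreal y} - (y - x) * F x)"
    using mean_excess_diff(1)[of x y] assms a_less_1 by (intro mult_left_mono) auto
  moreover have "(1 - a) * prob {ennreal x<..ennreal y} \<le> prob {ennreal x<..ennreal y}"
    using a_nonneg a_less_1 by (intro mult_left_le_one_le) auto
  ultimately show "(y - x) * rate x - prob {ennreal x<..ennreal y} \<le> gap y - gap x"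
    unfolding eq by (simp add: rate_def algebra_simps)
qed

text \<open>Otherwise \<open>gap\<close> would not grow from \<open>u\<close> to \<open>v\<close>
  while \<open>opt_cost\<close> does not shrink, and the ratio could not fall strictly.\<close>

lemma rate_pos:
  assumes "1 \<le> u" "u < v" "prob {ennreal u..ennreal v} = 0"
  shows "0 < rate v"
proof (rule ccontr)
  assume "\<not> 0 < rate v"
  then have "(v - u) * rate v \<le> 0" using assms by (simp add: mult_nonneg_nonpos)
  then have "gap v \<le> gap u" using gap_diff(1)[of u v] assms by simp
  moreover have "opt_cost a u \<le> opt_cost a v"
    using assms a_nonneg a_less_1 by (simp add: opt_cost_ge_1 mult_left_mono)
  ultimately have "gap v / opt_cost a v \<le> gap u / opt_cost a u"
    using assms gap_nonneg[of u] gap_nonneg[of v] opt_cost_pos[OF _ a_nonneg a_less_1, of u]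
    by (intro frac_le) auto
  then show False
    using mean_ratio_steep[OF assms] assms by (simp add: mean_ratio_gap)
qed

text \<open>As \<open>F\<close> is monotone, a rate that is still not positive at
  \<open>x + 1\<close> leaves no mass in between, against \<open>rate_pos\<close>. Hence the rate is
  either negative on all of \<open>[1, \<infinity>)\<close> or positive somewhere.\<close>

lemma rate_pos_Suc:
  assumes "1 \<le> x" "0 \<le> rate x"
  shows "0 < rate (x + 1)"
proof (rule ccontr)
  assume "\<not> 0 < rate (x + 1)"
  then have "F (x + 1) \<le> F x"
    using assms a_less_1 unfolding rate_def
    by (smt (verit) mult_le_cancel_left_pos)
  then have "prob {ennreal x<..ennreal (x + 1)} \<le> 0"
    using F_diff[of x "x + 1"] by simp
  \<comment> \<open>The closed interval starts at \<open>x + 1/2\<close> because the point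
    \<open>x\<close> itself may carry mass.\<close>
  moreover have "prob {ennreal (x + 1/2)..ennreal (x + 1)} \<le> prob {ennreal x<..ennreal (x + 1)}"
  proof (intro finite_measure_mono)
    have "ennreal x < ennreal (x + 1/2)" using assms by (intro ennreal_lessI) auto
    then show "{ennreal (x + 1/2)..ennreal (x + 1)} \<subseteq> {ennreal x<..ennreal (x + 1)}"
      by (meson atLeastAtMost_iff greaterThanAtMost_iff less_le_trans subsetI)
  qed simp
  ultimately have "prob {ennreal (x + 1/2)..ennreal (x + 1)} = 0"
    using measure_nonneg[of f "{ennreal (x + 1/2)..ennreal (x + 1)}"] by linarith
  then show False using rate_pos[of "x + 1/2" "x + 1"] assms \<open>\<not> 0 < rate (x + 1)\<close> by simp
qed

section \<open>Effect of moving weighted mass to a far point\<close>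

definition gain :: "(ennreal \<Rightarrow> real) \<Rightarrow> real \<Rightarrow> real \<Rightarrow> real" where
  "gain w y x = (LINT t|f. w t * (real_ratio a x t - real_ratio a x (ennreal y)))"

text \<open>
  Moving the mass \<open>\<epsilon> w\<close> to \<open>y\<close> lowers the ratio at \<open>x\<close> by \<open>\<epsilon>\<close> times the gain. A gain that is
  negative somewhere does no harm for small \<open>\<epsilon>\<close> if the ratio is bounded away from \<open>c\<close> there.
\<close>

definition improvable_at :: "real \<Rightarrow> bool" where
  "improvable_at y \<longleftrightarrow> (\<exists>w B \<zeta>. w \<in> borel_measurable borel \<and> (\<forall>t. 0 \<le> w t \<and> w t \<le> B) \<and> 0 < \<zeta> \<and>
     (\<forall>x>0. mean_ratio x \<le> c - \<zeta> \<or> \<zeta> \<le> gain w y x))"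

text \<open>The share \<open>x / opt_cost a x\<close> of pure renting occurs in both ratios and
  cancels.\<close>

lemma gain_eq:
  assumes "0 < x"
  shows "gain w y x = (1 - a) / opt_cost a x * (LINT t|f. w t * (excess x t - excess x (ennreal y)))"
proof -
  have "gain w y x
      = (LINT t|f. (1 - a) / opt_cost a x * (w t * (excess x t - excess x (ennreal y))))"
    unfolding gain_def real_ratio_def
    by (intro Bochner_Integration.integral_cong refl)
      (simp add: add_divide_distrib diff_divide_distrib algebra_simps)
  then show ?thesis by simp
qed

lemma integrable_weighted:
  assumes "w \<in> borel_measurable borel" "\<And>t. 0 \<le> w t" "\<And>t. w t \<le> (B::real)" "0 < x"
  shows "integrable f (\<lambda>t. w t * (excess x t - d))"
proof (rule integrable_bounded)
  show "\<bar>w t * (excess x t - d)\<bar> \<le> B * (1 + x + \<bar>d\<bar>)" for t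
    using assms(2,3)[of t] abs_excess_le[OF assms(4), of t]
    unfolding abs_mult by (intro mult_mono) auto
  show "(\<lambda>t. w t * (excess x t - d)) \<in> borel_measurable borel"
    using assms(1) by measurable
qed

lemma mean_ratio_excess:
  assumes "0 < x" "x \<le> 1"
  shows "(1 - a) / opt_cost a x * mean_excess x = mean_ratio x - 1"
  using assms a_less_1 by (simp add: mean_ratio_def opt_cost_le_1 add_divide_distrib)

section \<open>Improvement when the rate is negative throughout\<close>

lemma improvable_at_if_rate_neg:
  assumes neg: "\<And>x. 1 \<le> x \<Longrightarrow> rate x < 0" and y: "1 < y"
  shows "improvable_at y"
proof -
  define m where "m = prob {ennreal (y + 1)..ennreal (y + 2)}"
  have "m \<noteq> 0"
    using rate_pos[of "y + 1" "y + 2"] neg[of "y + 2"] y unfolding m_def by fastforce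
  then have m: "0 < m" by (simp add: m_def less_le)
  \<comment> \<open>The first bound makes up for the growth of \<open>opt_cost\<close> with slope
    \<open>a\<close>, the second for its constant part and for the loss of at most \<open>y\<close>
    from the mass before \<open>y\<close>.\<close>
  define W where "W = max (1 / (c - 1)) ((y + (y + 1) / (1 - a)) / m)"
  have "1 / (c - 1) \<le> W" "(y + (y + 1) / (1 - a)) / m \<le> W" by (simp_all add: W_def)
  then have W: "1 \<le> W * (c - 1)" "(y + 1) / (1 - a) \<le> W * m - y" and W0: "0 \<le> W"
  proof -
    show "1 \<le> W * (c - 1)"
      using \<open>1 / (c - 1) \<le> W\<close> c_gt_1 by (simp add: pos_divide_le_eq)
    show "(y + 1) / (1 - a) \<le> W * m - y"
      using \<open>(y + (y + 1) / (1 - a)) / m \<le> W\<close> m by (simp add: pos_divide_le_eq)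
    show "0 \<le> W" using \<open>1 / (c - 1) \<le> W\<close> c_gt_1
      by (meson diff_gt_0_iff_gt less_imp_le order_trans zero_le_divide_1_iff)
  qed
  define w where "w = (\<lambda>t. if t \<le> ennreal y then 1 else W)"
  have w_meas: "w \<in> borel_measurable borel" unfolding w_def by measurable
  have w_bounds: "0 \<le> w t" "w t \<le> max 1 W" for t using W0 by (auto simp: w_def)
  \<comment> \<open>The point \<open>y + 3\<close> lies one unit beyond the range
    \<open>x \<le> y + 2\<close>: \<open>gap\<close> still has to fall by \<open>s\<close> before
    reaching it and is nonnegative there.\<close>
  define s where "s = - rate (y + 3)"
  have s: "0 < s" using neg[of "y + 3"] y by (simp add: s_def)
  \<comment> \<open>One entry for each of the ranges \<open>x \<le> 1\<close>,
    \<open>1 < x \<le> y + 2\<close> and \<open>y + 2 < x\<close>.\<close>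
  define \<zeta> where "\<zeta> = Min {(c - 1) / 2, s / (y + 2), 1}"
  have \<zeta>: "0 < \<zeta>" "\<zeta> \<le> (c - 1) / 2" "\<zeta> \<le> s / (y + 2)" "\<zeta> \<le> 1"
  proof -
    show "0 < \<zeta>" using c_gt_1 s y by (simp add: \<zeta>_def)
  qed (unfold \<zeta>_def; rule Min_le; simp)+
  have "mean_ratio x \<le> c - \<zeta> \<or> \<zeta> \<le> gain w y x" if x: "0 < x" for x
  proof -
    consider "x \<le> 1" | "1 < x" "x \<le> y + 2" | "y + 2 < x" by linarith
    then show ?thesis
    proof cases
      case 1
      have "excess x (ennreal y) = 0" using 1 x y by (simp add: ennreal_lessI)
      \<comment> \<open>Only purchases up to \<open>x < y\<close> have an excess, and these carry
        weight \<open>1\<close>.\<close>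
      moreover have "w t * excess x t = excess x t" for t
        using 1 y by (auto simp: w_def excess_def dest: order_trans[OF _ ennreal_leI[of x y]])
      ultimately have "(\<lambda>t. w t * (excess x t - excess x (ennreal y))) = excess x"
        by (simp only: diff_zero)
      then have "gain w y x = mean_ratio x - 1"
        using mean_ratio_excess[of x] 1 x by (simp add: gain_eq mean_excess_def)
      then show ?thesis using \<zeta> by argo
    next
      case 2
      have "gap (y + 3) - gap x \<le> - ((y + 3 - x) * s)"
        using gap_diff(1)[of x "y + 3"] 2 by (simp add: s_def)
      moreover have "s \<le> (y + 3 - x) * s" using 2 s mult_right_mono[of 1 "y + 3 - x" s] by simp
      ultimately have "s \<le> gap x" using gap_nonneg[of "y + 3"] y by linarith
      then show ?thesis
        using mean_ratio_le_if_gap_ge[of x "y + 2" s] 2 s \<zeta> by linarith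
    next
      case 3
      define D where "D = x - 1 - y"
      have "1 \<le> D" using 3 by (simp add: D_def)
      have y_excess: "excess x (ennreal y) = - D" using 3 y by (simp add: D_def)
      \<comment> \<open>Relative to \<open>y\<close>, mass before \<open>y\<close> loses at most
        \<open>y\<close>, mass in \<open>[y + 1, y + 2]\<close> wins at least \<open>W\<close>, and
        mass beyond \<open>x\<close> wins \<open>W * D\<close>.\<close>
      have "W * indicator {ennreal (y + 1)..ennreal (y + 2)} t + W * D * indicator {ennreal x<..} t - y
          \<le> w t * (excess x t - - D)" for t
        using x
      proof (cases rule: ennreal_le_cases[of x t])
        case (le s)
        have "W \<le> W * (s - y)" if "y + 1 \<le> s" using that W0 mult_left_mono[of 1 "s - y" W] by simp
        moreover have "0 \<le> W * (s - y)" if "y \<le> s" using that W0 by simp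
        moreover have i0: "indicator {ennreal x<..} t = (0::real)"
          using le by (simp add: leD ennreal_leI)
        ultimately show ?thesis unfolding i0 using le y
          by (auto simp: w_def D_def indicator_def not_le not_less
              simp del: ennreal_plus)
      next
        case gt
        moreover have "ennreal y < ennreal x" "ennreal (y + 2) < ennreal x"
          using 3 y by (auto intro!: ennreal_lessI simp del: ennreal_plus)
        ultimately have "ennreal y < t" "ennreal (y + 2) < t" by (meson less_trans)+
        then have "t \<notin> {ennreal (y + 1)..ennreal (y + 2)}" "w t = W" "t \<in> {ennreal x<..}"
          using gt by (simp_all add: w_def not_le del: ennreal_plus)
        then show ?thesis using gt y by (simp del: ennreal_plus atLeastAtMost_iff)
      qed
      then have "(LINT t|f. W * indicator {ennreal (y + 1)..ennreal (y + 2)} t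
            + W * D * indicator {ennreal x<..} t - y)
          \<le> (LINT t|f. w t * (excess x t - - D))"
        using x w_bounds w_meas
        by (intro integral_mono integrable_weighted[where B = "max 1 W"]) auto
      moreover have "prob {ennreal x<..} = 1 - F x"
        using prob_compl[of "{..ennreal x}"] by (simp add: Compl_eq_Diff_UNIV[symmetric])
      ultimately have "W * m - y + W * D * (1 - F x) \<le> (LINT t|f. w t * (excess x t - - D))"
        by (simp add: m_def)
      then have "(1 - a) * (W * m - y + W * D * (1 - F x))
          \<le> (1 - a) * (LINT t|f. w t * (excess x t - - D))"
        using a_less_1 by (intro mult_left_mono) auto
      moreover have "opt_cost a x \<le> (1 - a) * (W * m - y + W * D * (1 - F x))"
      proof -
        \<comment> \<open>A negative rate forces mass beyond \<open>x\<close>, enough to pay for the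
          part \<open>a * D\<close> of \<open>opt_cost\<close>.\<close>
        have "a * (c - 1) \<le> (1 - a) * (1 - F x)"
          using neg[of x] 3 y by (simp add: rate_def algebra_simps)
        then have "W * D * (a * (c - 1)) \<le> W * D * ((1 - a) * (1 - F x))"
          using W0 \<open>1 \<le> D\<close> by (intro mult_left_mono) auto
        moreover have "a * D * 1 \<le> a * D * (W * (c - 1))"
          using W \<open>1 \<le> D\<close> a_nonneg by (intro mult_left_mono) auto
        moreover have "y + 1 \<le> (1 - a) * (W * m - y)"
          using W(2) a_less_1 by (simp add: pos_divide_le_eq mult.commute)
        moreover have "opt_cost a x \<le> y + 1 + a * D"
          using 3 y a_less_1 mult_right_mono[of a 1 y] by (simp add: opt_cost_ge_1 D_def algebra_simps)
        ultimately show ?thesis by (simp add: algebra_simps)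
      qed
      ultimately have "opt_cost a x \<le> (1 - a) * (LINT t|f. w t * (excess x t - excess x (ennreal y)))"
        unfolding y_excess by linarith
      then have "1 \<le> gain w y x"
        using opt_cost_pos[OF _ a_nonneg a_less_1, of x] x by (simp add: gain_eq)
      then show ?thesis using \<zeta> by simp
    qed
  qed
  then show ?thesis
    unfolding improvable_at_def using w_meas w_bounds \<zeta>(1) by blast
qed

section \<open>Improvement when the rate becomes positive\<close>

text \<open>Compactness makes the assumption on zero intervals uniform. Counterexamples for ever
  smaller \<open>m\<close> accumulate at some \<open>l\<close>; an interval just left of
  \<open>l\<close> is null, so \<open>gap\<close> grows there at a positive rate and cannot tend to
  \<open>0\<close> along the sequence.\<close>

lemma tight_points_have_mass:
  assumes T: "1 \<le> T"
  obtains m where "0 < m"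
    "\<And>x. x \<in> {1..T} \<Longrightarrow> mean_ratio x \<le> c - m \<or> m \<le> mean_excess x \<or>
      m \<le> prob {ennreal (x - 1/2)<..ennreal x}"
proof (rule ccontr)
  assume *: "\<not> thesis"
  define e where "e = (\<lambda>n. inverse (real (Suc n)))"
  have e_pos: "0 < e n" for n by (simp add: e_def)
  have "\<forall>n. \<exists>x. x \<in> {1..T} \<and> c - e n < mean_ratio x \<and> mean_excess x < e n \<and>
      prob {ennreal (x - 1/2)<..ennreal x} < e n"
    using * that[OF e_pos] by (meson not_le)
  then obtain X where X: "X n \<in> {1..T}" "c - e n < mean_ratio (X n)" "mean_excess (X n) < e n"
      "prob {ennreal (X n - 1/2)<..ennreal (X n)} < e n" for n
    by metis
  obtain l r where l: "l \<in> {1..T}" and r: "strict_mono (r :: nat \<Rightarrow> nat)" "(X \<circ> r) \<longlonglongrightarrow> l"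
    using compact_Icc[of 1 T, unfolded compact_def] X(1) by metis
  have er: "(\<lambda>n. e (r n)) \<longlonglongrightarrow> 0"
    using LIMSEQ_subseq_LIMSEQ[OF LIMSEQ_inverse_real_of_nat r(1)] by (simp add: e_def o_def)
  have Xr: "(\<lambda>n. X (r n)) \<longlonglongrightarrow> l" using r(2) by (simp add: o_def)
  \<comment> \<open>With a small mean excess the ratio at \<open>X n\<close> is hardly above
    \<open>X n\<close>. Hence \<open>l \<ge> c > 1\<close>, which leaves room to the left of
    \<open>l\<close> within \<open>[1, \<infinity>)\<close>.\<close>
  have "c - 2 * e n \<le> X n" for n
  proof -
    have 1: "1 \<le> X n" using X(1)[of n] by simp
    have "(1 - a) * mean_excess (X n) \<le> e n"
    proof (rule order_trans)
      show "(1 - a) * mean_excess (X n) \<le> (1 - a) * e n"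
        using X(3)[of n] a_less_1 by (intro mult_left_mono) auto
      show "(1 - a) * e n \<le> e n"
        using e_pos[of n] a_nonneg a_less_1 by (intro mult_left_le_one_le) auto
    qed
    then have "mean_ratio (X n) \<le> (X n + e n) / opt_cost a (X n)"
      using 1 opt_cost_pos[OF _ a_nonneg a_less_1, of "X n"]
      unfolding mean_ratio_def by (intro divide_right_mono) auto
    also have "\<dots> \<le> (X n + e n) / 1"
      using 1 one_le_opt_cost[OF 1 a_nonneg a_less_1] e_pos[of n] by (intro divide_left_mono) auto
    finally show ?thesis using X(2)[of n] by simp
  qed
  then have "c - 2 * 0 \<le> l"
    by (intro LIMSEQ_le[OF tendsto_diff[OF tendsto_const tendsto_mult[OF tendsto_const er]] Xr]) auto
  \<comment> \<open>The bound \<open>1/8\<close> puts \<open>[l - 2 * s, l - s]\<close> inside the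
    half unit before \<open>X (r n)\<close> for large \<open>n\<close>; the bound
    \<open>(c - 1) / 2\<close> keeps it to the right of \<open>1\<close>.\<close>
  define s where "s = min (1/8) ((c - 1) / 2)"
  have s: "0 < s" "s \<le> 1/8" "1 \<le> l - 2 * s"
    using c_gt_1 \<open>c - 2 * 0 \<le> l\<close> by (auto simp: s_def min_def field_simps)
  define u v where "u = l - 2 * s" and "v = l - s"
  have uv: "1 \<le> u" "u < v" using s by (auto simp: u_def v_def)
  have close: "eventually (\<lambda>n. dist (X (r n)) l < s / 2) sequentially"
    using Xr s by (intro tendstoD) auto
  have "eventually (\<lambda>n. prob {ennreal u..ennreal v} \<le> e (r n)) sequentially"
    using close
  proof eventually_elim
    case (elim n)
    then have "X (r n) - l < s / 2" "l - X (r n) < s / 2"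
      unfolding dist_real_def by linarith+
    moreover have "1 \<le> X (r n)" using X(1)[of "r n"] by simp
    ultimately have "X (r n) - 1/2 < u" "v \<le> X (r n)" "0 \<le> X (r n)"
      using s unfolding u_def v_def by linarith+
    then have "ennreal (X (r n) - 1/2) < ennreal u" "ennreal v \<le> ennreal (X (r n))"
      using uv by (auto intro: ennreal_lessI ennreal_leI)
    then have "prob {ennreal u..ennreal v} \<le> prob {ennreal (X (r n) - 1/2)<..ennreal (X (r n))}"
      by (intro finite_measure_mono) (auto intro: less_le_trans order_trans)
    then show ?case using X(4)[of "r n"] by linarith
  qed
  then have "prob {ennreal u..ennreal v} \<le> 0"
    by (intro tendsto_lowerbound[OF er]) auto
  then have "prob {ennreal u..ennreal v} = 0"
    using measure_nonneg by (simp add: order_antisym)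
  then have pos: "0 < rate v" using uv by (rule rate_pos[rotated 2])
  \<comment> \<open>Between \<open>v\<close> and \<open>X (r n)\<close> the function
    \<open>gap\<close> gains at least \<open>s / 2 * rate v\<close> minus a mass of at most
    \<open>e (r n)\<close>, yet near tightness it is at most \<open>T * e (r n)\<close>.\<close>
  have "eventually (\<lambda>n. s / 2 * rate v \<le> (T + 1) * e (r n)) sequentially"
    using close
  proof eventually_elim
    case (elim n)
    let ?x = "X (r n)"
    have "?x - l < s / 2" "l - ?x < s / 2"
      using elim unfolding dist_real_def by linarith+
    moreover have "1 \<le> ?x" "?x \<le> T" using X(1)[of "r n"] by auto
    ultimately have x: "1 \<le> ?x" "?x \<le> T" "v + s / 2 \<le> ?x" "?x - 1/2 \<le> v"
      using s unfolding v_def by linarith+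
    have "prob {ennreal v<..ennreal ?x} \<le> prob {ennreal (?x - 1/2)<..ennreal ?x}"
    proof (intro finite_measure_mono)
      have "ennreal (?x - 1/2) \<le> ennreal v" using x by (intro ennreal_leI)
      then show "{ennreal v<..ennreal ?x} \<subseteq> {ennreal (?x - 1/2)<..ennreal ?x}" by auto
    qed simp
    then have "prob {ennreal v<..ennreal ?x} \<le> e (r n)" using X(4)[of "r n"] by linarith
    moreover have "s / 2 * rate v \<le> (?x - v) * rate v"
      using x pos by (intro mult_right_mono) auto
    moreover have "(?x - v) * rate v - prob {ennreal v<..ennreal ?x} \<le> gap ?x - gap v"
      using x s uv by (intro gap_diff(2)) auto
    moreover have "gap ?x / opt_cost a ?x \<le> e (r n)"
      using X(2)[of "r n"] x by (simp add: mean_ratio_gap)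
    then have "gap ?x \<le> e (r n) * opt_cost a ?x"
      using opt_cost_pos[OF _ a_nonneg a_less_1, of ?x] x by (simp add: pos_divide_le_eq)
    moreover have "e (r n) * opt_cost a ?x \<le> e (r n) * T"
      using opt_cost_le[of a ?x] x e_pos[of "r n"] by (intro mult_left_mono) auto
    moreover have "0 \<le> gap v" using uv by (intro gap_nonneg) auto
    ultimately show ?case by (simp add: algebra_simps)
  qed
  then have "s / 2 * rate v \<le> (T + 1) * 0"
    by (intro tendsto_lowerbound[OF tendsto_mult[OF tendsto_const er]]) auto
  then show False using pos s by (simp add: mult_le_0_iff)
qed

lemma improvable_at_if_rate_pos:
  assumes "1 \<le> x" "0 < rate x"
  obtains T where "1 \<le> T" "\<And>y. T < y \<Longrightarrow> improvable_at y"
proof -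
  define \<rho> where "\<rho> = rate x / 2"
  \<comment> \<open>Chosen so that \<open>(z - x) * rate x - 1\<close>, a lower bound of
    \<open>gap z\<close>, is at least \<open>z * \<rho>\<close> for all
    \<open>z \<ge> T\<close>.\<close>
  define T where "T = 1 / \<rho> + 2 * x"
  have \<rho>: "0 < \<rho>" using assms by (simp add: \<rho>_def)
  have T: "1 \<le> T" "x \<le> T" using assms \<rho> by (auto simp: T_def intro: add_nonneg_pos add_increasing)
  have tail: "mean_ratio z \<le> c - \<rho>" if z: "T \<le> z" for z
  proof -
    have "1 + 2 * x * \<rho> = T * \<rho>" using \<rho> by (simp add: T_def algebra_simps)
    also have "\<dots> \<le> z * \<rho>" using z \<rho> by simp
    finally have "z * \<rho> \<le> (z - x) * rate x - 1" by (simp add: \<rho>_def algebra_simps)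
    also have "\<dots> \<le> (z - x) * rate x - prob {ennreal x<..ennreal z}" by simp
    also have "\<dots> \<le> gap z - gap x" using T z assms by (intro gap_diff) auto
    also have "\<dots> \<le> gap z" using gap_nonneg[of x] assms by simp
    finally have "z * \<rho> \<le> gap z" .
    then have "mean_ratio z \<le> c - z * \<rho> / z"
      using T z \<rho> by (intro mean_ratio_le_if_gap_ge) auto
    then show ?thesis using T z by simp
  qed
  obtain m where m: "0 < m"
    and tight: "\<And>x. x \<in> {1..T} \<Longrightarrow> mean_ratio x \<le> c - m \<or> m \<le> mean_excess x \<or>
      m \<le> prob {ennreal (x - 1/2)<..ennreal x}"
    using tight_points_have_mass[OF T(1)] by blast
  \<comment> \<open>So large that mass \<open>m\<close> in the half unit before \<open>x\<close>,
    with factor \<open>exp (b / 2) / 2\<close>, outweighs a loss of \<open>T\<close> with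
    \<open>1\<close> to spare.\<close>
  define b where "b = 4 * (T + 1) / m"
  have b: "0 < b" using m T by (simp add: b_def)
  have "2 * (T + 1) / m = b / 2" using m by (simp add: b_def field_simps)
  also have "\<dots> \<le> exp (b / 2)" using exp_ge_add_one_self[of "b / 2"] by linarith
  finally have "2 * (T + 1) / m \<le> exp (b / 2)" .
  then have exp_b: "T + 1 \<le> exp (b / 2) / 2 * m"
    using m by (simp add: pos_divide_le_eq)
  define w where "w = (\<lambda>t. if t \<le> ennreal T then exp (b * enn2real t) else 0)"
  have w_meas: "w \<in> borel_measurable borel" unfolding w_def by measurable
  have w_bounds: "0 \<le> w t" "w t \<le> exp (b * T)" for t
    using b T enn2real_le[of t T] by (auto simp: w_def)
  \<comment> \<open>Two entries serve \<open>x \<le> 1\<close>, the next three the alternatives of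
    \<open>tight\<close>, and \<open>\<rho>\<close> the stopping times beyond
    \<open>T\<close>.\<close>
  define \<zeta> where "\<zeta> = Min {exp (- b) * ((c - 1) / 2), (c - 1) / 2, m, (1 - a) * m / T, (1 - a) / T, \<rho>}"
  have \<zeta>: "0 < \<zeta>" "\<zeta> \<le> exp (- b) * ((c - 1) / 2)" "\<zeta> \<le> (c - 1) / 2" "\<zeta> \<le> m"
    "\<zeta> \<le> (1 - a) * m / T" "\<zeta> \<le> (1 - a) / T" "\<zeta> \<le> \<rho>"
  proof -
    show "0 < \<zeta>" using c_gt_1 \<rho> T m a_less_1 by (simp add: \<zeta>_def)
  qed (unfold \<zeta>_def; rule Min_le; simp)+
  have "improvable_at y" if y: "T < y" for y
  proof -
    have "mean_ratio x \<le> c - \<zeta> \<or> \<zeta> \<le> gain w y x" if x: "0 < x" for x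
    proof (cases "x \<le> T")
      case False
      then show ?thesis using tail[of x] \<zeta> by force
    next
      case xT: True
      have "excess x (ennreal y) = 0" using x xT y by (simp add: ennreal_lessI)
      then have gain: "gain w y x = (1 - a) / opt_cost a x * (LINT t|f. w t * excess x t)"
        using x by (simp add: gain_eq)
      have int: "integrable f (\<lambda>t. w t * excess x t)"
        using integrable_weighted[OF w_meas w_bounds x, of 0] by simp
      \<comment> \<open>The weight increases up to \<open>x\<close> and the excess changes sign from
        negative to positive at \<open>x - 1\<close>; replacing the weight by its value there lowers
        the product on both sides.\<close>
      have "exp (b * (x - 1)) * excess x t \<le> w t * excess x t" for t
        using x
      proof (cases rule: ennreal_le_cases[of x t])
        case (le s)
        have "0 \<le> (exp (b * s) - exp (b * (x - 1))) * (1 - x + s)"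
          using b by (cases "x - 1 \<le> s") (auto intro: mult_nonneg_nonneg mult_nonpos_nonpos)
        then show ?thesis
          using le xT by (simp add: w_def ennreal_leI algebra_simps)
      qed simp
      then have "(LINT t|f. exp (b * (x - 1)) * excess x t) \<le> (LINT t|f. w t * excess x t)"
        using x int by (intro integral_mono) auto
      then have weighted: "exp (b * (x - 1)) * mean_excess x \<le> (LINT t|f. w t * excess x t)"
        by (simp add: mean_excess_def)
      show ?thesis
      proof (cases "x \<le> 1")
        case True
        have "exp (b * (x - 1)) * (mean_ratio x - 1)
            = (1 - a) / opt_cost a x * (exp (b * (x - 1)) * mean_excess x)"
          unfolding mean_ratio_excess[OF x True, symmetric] by (rule mult.left_commute)
        also have "\<dots> \<le> gain w y x"
          unfolding gain using weighted a_less_1 opt_cost_pos[OF x a_nonneg a_less_1]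
          by (intro mult_left_mono) auto
        finally have *: "exp (b * (x - 1)) * (mean_ratio x - 1) \<le> gain w y x" .
        show ?thesis
        proof (cases "mean_ratio x \<le> c - (c - 1) / 2")
          case True
          then show ?thesis using \<zeta> by linarith
        next
          case False
          have "exp (- b) * ((c - 1) / 2) \<le> exp (b * (x - 1)) * (mean_ratio x - 1)"
          proof (intro mult_mono)
            show "exp (- b) \<le> exp (b * (x - 1))" using b x by (simp add: algebra_simps)
            show "(c - 1) / 2 \<le> mean_ratio x - 1" using False by argo
          qed (use c_gt_1 in auto)
          then show ?thesis using * \<zeta> by linarith
        qed
      next
        case False
        have ge: "d / T \<le> gain w y x" if "0 \<le> d" "d \<le> (1 - a) * (LINT t|f. w t * excess x t)" for d
        proof -
          have "d / T \<le> (1 - a) * (LINT t|f. w t * excess x t) / opt_cost a x"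
            using that xT opt_cost_le[of a x] opt_cost_pos[OF x a_nonneg a_less_1]
            by (intro frac_le) auto
          then show ?thesis by (simp add: gain)
        qed
        have exp_ge_1: "1 \<le> exp (b * (x - 1))" using b False by simp
        consider "mean_ratio x \<le> c - m" | "m \<le> mean_excess x"
          | "m \<le> prob {ennreal (x - 1/2)<..ennreal x}"
          using tight[of x] False xT by auto
        then show ?thesis
        proof cases
          case 1
          then show ?thesis using \<zeta> by linarith
        next
          case 2
          then have "1 * m \<le> exp (b * (x - 1)) * mean_excess x"
            using exp_ge_1 m by (intro mult_mono) auto
          then have "m \<le> (LINT t|f. w t * excess x t)" using weighted by simp
          then have "(1 - a) * m / T \<le> gain w y x"
            using m a_less_1 by (intro ge mult_left_mono) auto
          then show ?thesis using \<zeta> by linarith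
        next
          case 3
          let ?I = "indicator {ennreal (x - 1/2)<..ennreal x} :: ennreal \<Rightarrow> real"
          \<comment> \<open>In the half unit before \<open>x\<close> the excess is at least
            \<open>1/2\<close> and the weight at least \<open>exp (b * (x - 1/2))\<close>. Losses
            occur only before \<open>x - 1\<close>, where the weight is below
            \<open>exp (b * (x - 1))\<close> and the excess at least \<open>-T\<close>.\<close>
          have "exp (b * (x - 1)) * (exp (b / 2) / 2 * ?I t - T) \<le> w t * excess x t" for t
            using x
          proof (cases rule: ennreal_le_cases[of x t])
            case (le s)
            then have wt: "w t * excess x t = exp (b * s) * (1 - x + s)"
              using xT by (simp add: w_def ennreal_leI)
            consider "x - 1/2 < s" | "x - 1 \<le> s" "s \<le> x - 1/2" | "s < x - 1" by linarith
            then show ?thesis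
            proof cases
              case 1
              have "exp (b * (x - 1)) * (exp (b / 2) / 2 * ?I t - T)
                  \<le> exp (b * (x - 1)) * (exp (b / 2) * (1 / 2))"
              proof (intro mult_left_mono)
                have "exp (b / 2) / 2 * ?I t \<le> exp (b / 2) / 2 * 1"
                  by (intro mult_left_mono) (auto simp: indicator_def)
                then show "exp (b / 2) / 2 * ?I t - T \<le> exp (b / 2) * (1 / 2)"
                  using T by linarith
              qed simp
              also have "\<dots> = exp (b * (x - 1/2)) * (1 / 2)"
                by (simp add: algebra_simps flip: exp_add)
              also have "\<dots> \<le> exp (b * s) * (1 - x + s)"
                using 1 b by (intro mult_mono) auto
              finally show ?thesis by (simp add: wt)
            next
              case 2
              then have "?I t = 0"
                using le False by (auto simp: indicator_def ennreal_less_iff)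
              then show ?thesis using 2 T unfolding wt by (auto intro: order_trans[of _ 0])
            next
              case 3
              then have "?I t = 0"
                using le False by (auto simp: indicator_def ennreal_less_iff)
              moreover have "exp (b * s) * (x - 1 - s) \<le> exp (b * (x - 1)) * T"
                using 3 b le xT T by (intro mult_mono) auto
              ultimately show ?thesis unfolding wt by (simp add: algebra_simps)
            qed
          next
            case gt
            then have "t \<notin> {ennreal (x - 1/2)<..ennreal x}" by (simp add: not_le)
            then show ?thesis using T gt by (simp del: greaterThanAtMost_iff)
          qed
          then have "(LINT t|f. exp (b * (x - 1)) * (exp (b / 2) / 2 * ?I t - T))
              \<le> (LINT t|f. w t * excess x t)"
            using int by (intro integral_mono) auto
          moreover have "(LINT t|f. exp (b * (x - 1)) * (exp (b / 2) / 2 * ?I t - T))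
              = exp (b * (x - 1)) * (exp (b / 2) / 2 * prob {ennreal (x - 1/2)<..ennreal x} - T)"
            by simp
          moreover have "1 * 1 \<le> exp (b * (x - 1)) *
              (exp (b / 2) / 2 * prob {ennreal (x - 1/2)<..ennreal x} - T)"
          proof (intro mult_mono exp_ge_1)
            have "exp (b / 2) / 2 * m \<le> exp (b / 2) / 2 * prob {ennreal (x - 1/2)<..ennreal x}"
              using 3 by (intro mult_left_mono) auto
            then show "1 \<le> exp (b / 2) / 2 * prob {ennreal (x - 1/2)<..ennreal x} - T"
              using exp_b by linarith
          qed auto
          ultimately have "1 \<le> (LINT t|f. w t * excess x t)" by linarith
          then have "(1 - a) / T \<le> gain w y x"
            using a_less_1 mult_left_mono[of 1 _ "1 - a"] by (intro ge) auto
          then show ?thesis using \<zeta> by linarith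
        qed
      qed
    qed
    then show ?thesis
      unfolding improvable_at_def using w_meas w_bounds \<zeta>(1) by blast
  qed
  then show ?thesis using that T(1) by blast
qed

section \<open>From a positive gain to a better distribution\<close>

text \<open>The target can be taken arbitrarily far out, as the tail constraint will demand.\<close>

lemma improvable:
  obtains y where "M < y" "1 < y" "improvable_at y"
proof (cases "\<exists>x\<ge>1. 0 \<le> rate x")
  case True
  then obtain x where "1 \<le> x" "0 < rate (x + 1)" using rate_pos_Suc by blast
  then obtain T where T: "1 \<le> T" "\<And>y. T < y \<Longrightarrow> improvable_at y"
    using improvable_at_if_rate_pos[of "x + 1"] by auto
  then show ?thesis using that[of "max M T + 1"] by auto
next
  case False
  then show ?thesis
    using that[of "max M 1 + 1"] improvable_at_if_rate_neg[of "max M 1 + 1"] by fastforce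
qed

text \<open>The last two properties serve feasibility: sets that miss \<open>y\<close> receive no
  mass, and the mass moved is at most \<open>\<eta>\<close> in total.\<close>

lemma improving_displacement:
  assumes "improvable_at y" "1 < y" "0 < \<eta>"
  obtains g where "purchase_distribution g" "worst_ratio a g < ennreal c"
    "\<And>A. A \<in> sets borel \<Longrightarrow> ennreal y \<notin> A \<Longrightarrow> measure g A \<le> prob A"
    "\<And>A. A \<in> sets borel \<Longrightarrow> measure g A \<le> prob A + \<eta>"
proof -
  obtain w B \<zeta> where [measurable]: "w \<in> borel_measurable borel"
    and w: "\<And>t. 0 \<le> w t" "\<And>t. w t \<le> B" and \<zeta>: "0 < \<zeta>"
    and better: "\<And>x. 0 < x \<Longrightarrow> mean_ratio x \<le> c - \<zeta> \<or> \<zeta> \<le> gain w y x"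
    using assms(1) unfolding improvable_at_def by blast
  have B: "0 \<le> B" using w[of 0] by linarith
  \<comment> \<open>The three minima ensure that \<open>u\<close> is a probability, that at most
    \<open>\<eta>\<close> is moved, and that the harm stays within half of the slack
    \<open>\<zeta>\<close>. Using \<open>B + 1\<close> keeps the denominator positive.\<close>
  define \<epsilon> where "\<epsilon> = min (min 1 \<eta>) (\<zeta> / 2) / ((B + 1) * (1 + y))"
  have den: "1 \<le> (B + 1) * (1 + y)" using B assms(2) mult_mono[of 1 "B + 1" 1 "1 + y"] by simp
  have \<epsilon>: "0 < \<epsilon>" using assms \<zeta> den by (simp add: \<epsilon>_def)
  have "\<epsilon> * ((B + 1) * (1 + y)) = min (min 1 \<eta>) (\<zeta> / 2)"
    using den by (metis \<epsilon>_def nonzero_eq_divide_eq not_one_le_zero)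
  moreover have "\<epsilon> * (B * (1 + y)) \<le> \<epsilon> * ((B + 1) * (1 + y))"
    using \<epsilon> assms(2) by (intro mult_left_mono mult_right_mono) auto
  moreover have "\<epsilon> * (B * 1) \<le> \<epsilon> * (B * (1 + y))"
    using \<epsilon> B assms(2) by (intro mult_left_mono) auto
  ultimately have \<epsilon>B: "\<epsilon> * B \<le> 1" "\<epsilon> * B \<le> \<eta>" "\<epsilon> * (B * (1 + y)) \<le> \<zeta> / 2" by auto
  define u where "u = (\<lambda>t. \<epsilon> * w t)"
  have u_meas [measurable]: "u \<in> borel_measurable borel" unfolding u_def by measurable
  have u_nonneg: "0 \<le> u t" and uB: "u t \<le> \<epsilon> * B" for t
    using \<epsilon> w by (auto simp: u_def)
  have u: "0 \<le> u t" "u t \<le> 1" "u t \<le> \<eta>" for t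
    using u_nonneg[of t] uB[of t] \<epsilon>B by linarith+
  obtain g where g: "prob_space g" "sets g = sets borel"
    "\<And>h. h \<in> borel_measurable borel \<Longrightarrow>
      (\<integral>\<^sup>+ t. h t \<partial>g) = (\<integral>\<^sup>+ t. ennreal (1 - u t) * h t + ennreal (u t) * h (ennreal y) \<partial>f)"
    using displaced_measure_exists[OF prob_space_axioms sets_f u_meas u(1,2), of "ennreal y"] by blast
  interpret G: two_slope a g
    using a_nonneg a_less_1 g(1,2) by unfold_locales (auto simp: purchase_distribution_def)
  \<comment> \<open>The first bound is for stopping times with slack \<open>\<zeta>\<close>, the
    second for those with gain at least \<open>\<zeta>\<close>.\<close>
  have G_ratio: "G.mean_ratio x \<le> max (c - \<zeta> / 2) (c - \<epsilon> * \<zeta>)" if x: "0 < x" for x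
  proof -
    let ?y = "real_ratio a x (ennreal y)"
    have r_nonneg: "0 \<le> real_ratio a x t" for t
      using real_ratio_ge_1[OF a_nonneg a_less_1 x, of t] by simp
    have y_le: "?y \<le> 1 + y" using real_ratio_le[OF a_nonneg a_less_1 _ x] assms(2) by simp
    have int: "integrable f (\<lambda>t. w t * (real_ratio a x t - ?y))"
    proof -
      have "w t * (real_ratio a x t - ?y)
          = (1 - a) / opt_cost a x * (w t * (excess x t - excess x (ennreal y)))" for t
        by (simp add: real_ratio_def add_divide_distrib diff_divide_distrib algebra_simps)
      then show ?thesis using integrable_weighted[OF _ w x] by simp
    qed
    have "ennreal (G.mean_ratio x)
        = (\<integral>\<^sup>+ t. ennreal (1 - u t) * ennreal (real_ratio a x t) + ennreal (u t) * ennreal ?y \<partial>f)"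
      using x by (simp add: g(3) expected_ratio_def ratio_eq_real_ratio[OF a_nonneg a_less_1]
          flip: G.expected_ratio_eq)
    also have "\<dots> = (\<integral>\<^sup>+ t. ennreal (real_ratio a x t - \<epsilon> * (w t * (real_ratio a x t - ?y))) \<partial>f)"
    proof (intro nn_integral_cong)
      fix t
      have "real_ratio a x t - \<epsilon> * (w t * (real_ratio a x t - ?y)) = (1 - u t) * real_ratio a x t + u t * ?y"
        by (simp add: u_def algebra_simps)
      then show "ennreal (1 - u t) * ennreal (real_ratio a x t) + ennreal (u t) * ennreal ?y
          = ennreal (real_ratio a x t - \<epsilon> * (w t * (real_ratio a x t - ?y)))"
        using u[of t] r_nonneg by (simp add: ennreal_mult[symmetric] ennreal_plus[symmetric] del: ennreal_plus)
    qed
    also have "\<dots> = ennreal (mean_ratio x - \<epsilon> * gain w y x)"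
    proof -
      have "0 \<le> real_ratio a x t - \<epsilon> * (w t * (real_ratio a x t - ?y))" for t
      proof -
        have "real_ratio a x t - \<epsilon> * (w t * (real_ratio a x t - ?y)) = (1 - u t) * real_ratio a x t + u t * ?y"
          by (simp add: u_def algebra_simps)
        then show ?thesis using u[of t] r_nonneg by simp
      qed
      then show ?thesis
        using int x by (subst nn_integral_eq_integral) (auto simp: mean_ratio_eq gain_def)
    qed
    finally have "ennreal (G.mean_ratio x) \<le> ennreal (mean_ratio x - \<epsilon> * gain w y x)" by (rule eq_refl)
    \<comment> \<open>Since \<open>G.mean_ratio x\<close> is at least \<open>1\<close>, the
      inequality does not come from truncation at \<open>0\<close>.\<close>
    then have "G.mean_ratio x \<le> mean_ratio x - \<epsilon> * gain w y x"
      using G.mean_ratio_ge_1[OF x] unfolding ennreal_le_iff2 by linarith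
    moreover have "mean_ratio x - \<epsilon> * gain w y x \<le> max (c - \<zeta> / 2) (c - \<epsilon> * \<zeta>)"
      using better[OF x]
    proof
      assume less: "mean_ratio x \<le> c - \<zeta>"
      have "- (B * (1 + y)) \<le> w t * (real_ratio a x t - ?y)" for t
      proof -
        have "w t * ?y \<le> B * (1 + y)" using w[of t] y_le r_nonneg by (intro mult_mono) auto
        moreover have "0 \<le> w t * real_ratio a x t" using w r_nonneg by simp
        ultimately show ?thesis by (simp add: algebra_simps)
      qed
      then have "(LINT t|f. - (B * (1 + y))) \<le> gain w y x"
        unfolding gain_def using int by (intro integral_mono) auto
      then have "\<epsilon> * - (B * (1 + y)) \<le> \<epsilon> * gain w y x" using \<epsilon> by (intro mult_left_mono) auto
      then show ?thesis using \<epsilon>B(3) less by (simp only: mult_minus_right)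
    next
      assume "\<zeta> \<le> gain w y x"
      then have "\<epsilon> * \<zeta> \<le> \<epsilon> * gain w y x" using \<epsilon> by simp
      then show ?thesis using mean_ratio_le[OF x] by linarith
    qed
    ultimately show ?thesis by linarith
  qed
  have "worst_ratio a g \<le> ennreal (max (c - \<zeta> / 2) (c - \<epsilon> * \<zeta>))"
    using G_ratio by (rule G.worst_ratio_le)
  also have "\<dots> < ennreal c" using c_gt_1 \<zeta> \<epsilon> by (intro ennreal_lessI) auto
  finally have worst: "worst_ratio a g < ennreal c" .
  have mass: "ennreal (measure g A)
      = (\<integral>\<^sup>+ t. ennreal (1 - u t) * indicator A t + ennreal (u t) * indicator A (ennreal y) \<partial>f)"
    if "A \<in> sets borel" for A
    using that g(3)[of "indicator A"] by (simp add: g(2) flip: G.emeasure_eq_measure)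
  show ?thesis
  proof (rule that[OF G.purchase_distribution worst])
    fix A :: "ennreal set" assume A: "A \<in> sets borel"
    show "measure g A \<le> prob A" if "ennreal y \<notin> A"
    proof -
      have "ennreal (measure g A) \<le> (\<integral>\<^sup>+ t. indicator A t \<partial>f)"
        unfolding mass[OF A] using u that
        by (intro nn_integral_mono) (auto simp: indicator_def ennreal_le_1)
      then show ?thesis using A by (simp add: emeasure_eq_measure)
    qed
    show "measure g A \<le> prob A + \<eta>"
    proof -
      have "ennreal (measure g A) \<le> (\<integral>\<^sup>+ t. indicator A t + ennreal \<eta> \<partial>f)"
        unfolding mass[OF A] using u
        by (intro nn_integral_mono add_mono) (auto simp: indicator_def ennreal_le_1 ennreal_leI)
      also have "\<dots> = ennreal (prob A + \<eta>)"
        using A assms(3) by (simp add: nn_integral_add emeasure_eq_measure emeasure_space_1[simplified])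
      finally show ?thesis using assms(3) by (simp del: ennreal_plus)
    qed
  qed
qed

end

section \<open>Bad intervals and the point \<open>L_b\<close>\<close>

locale tail_constraint =
  fixes a \<gamma> :: real
  assumes a_nonneg: "0 \<le> a" and a_less_1: "a < 1"
    and \<gamma>_ge: "2 - a \<le> \<gamma>" and \<gamma>_less: "a * \<gamma> < 1"
begin

lemma \<gamma>_gt_1: "1 < \<gamma>"
  using \<gamma>_ge a_less_1 by simp

lemma L_b_eq: "L_b a \<gamma> * (1 - a * \<gamma>) = \<gamma> - 1"
  using \<gamma>_less by (simp add: L_b_def)

lemma L_b_pos: "0 < L_b a \<gamma>"
  using \<gamma>_less \<gamma>_gt_1 by (simp add: L_b_def)

text \<open>That is, pure renting reaches ratio \<open>\<gamma>\<close> at the stopping time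
  \<open>L_b + 1\<close>.\<close>

lemma L_b_plus_1_eq: "(L_b a \<gamma> + 1) * (1 - a * \<gamma>) = \<gamma> * (1 - a)"
  using L_b_eq by algebra

text \<open>That is, buying at \<open>L_b\<close> has ratio exactly \<open>\<gamma>\<close> against
  the stopping time \<open>L_b + 1\<close>.\<close>

lemma L_b_identity: "(1 - a) * L_b a \<gamma> = (\<gamma> - 1) * (1 + a * L_b a \<gamma>)"
  using L_b_eq by algebra

lemma bad_interval_iff:
  "0 < x \<Longrightarrow> t \<in> bad_interval a \<gamma> (ennreal x) \<longleftrightarrow> \<gamma> < real_ratio a x t"
  using \<gamma>_gt_1 by (simp add: bad_interval_def ratio_eq_real_ratio a_nonneg a_less_1 ennreal_less_iff)

lemma bad_interval_infinity: "bad_interval a \<gamma> \<infinity> \<subseteq> {\<infinity>}"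
  using \<gamma>_gt_1 by (auto simp: bad_interval_def ratio_def ennreal_less_iff split: if_splits
      simp flip: ennreal_1)

lemma never_bad_if_late:
  assumes "0 < x" "x \<le> L_b a \<gamma> + 1" "ennreal x < t"
  shows "t \<notin> bad_interval a \<gamma> (ennreal x)"
proof -
  have "x * (1 - a * \<gamma>) \<le> (L_b a \<gamma> + 1) * (1 - a * \<gamma>)"
    using assms \<gamma>_less by (intro mult_right_mono) auto
  also note L_b_plus_1_eq
  finally have "x \<le> \<gamma> * (1 - a + a * x)" by (simp add: algebra_simps)
  moreover have "1 * x \<le> \<gamma> * x" using \<gamma>_gt_1 assms by (intro mult_right_mono) auto
  ultimately have "x \<le> \<gamma> * opt_cost a x" by (simp add: opt_cost_def min_def)
  then show ?thesis
    using assms opt_cost_pos[of x a] a_nonneg a_less_1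
    by (simp add: bad_interval_iff real_ratio_def pos_divide_le_eq not_less)
qed

text \<open>The ratio \<open>1 + (1 - a) * s / (1 - a + a * x)\<close> of buying at \<open>s\<close>
  increases in \<open>s\<close>, does not increase in \<open>x\<close>, and equals
  \<open>\<gamma>\<close> at \<open>s = L_b\<close>, \<open>x = L_b + 1\<close>.\<close>

lemma bad_interval_subset:
  assumes "L_b a \<gamma> + 1 < x"
  shows "bad_interval a \<gamma> (ennreal x) \<subseteq> {ennreal (L_b a \<gamma>)<..}"
proof (rule subsetI, rule ccontr)
  fix t assume bad: "t \<in> bad_interval a \<gamma> (ennreal x)" and "t \<notin> {ennreal (L_b a \<gamma>)<..}"
  then obtain s where s: "t = ennreal s" "0 \<le> s" "s \<le> L_b a \<gamma>"
    using ennreal_le_cases[OF L_b_pos, of t] by auto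
  have "(1 - a) * s \<le> (1 - a) * L_b a \<gamma>" using s a_less_1 by (intro mult_left_mono) auto
  also have "\<dots> \<le> (\<gamma> - 1) * (1 - a + a * x)"
    unfolding L_b_identity using assms \<gamma>_gt_1 a_nonneg mult_left_mono[of "L_b a \<gamma> + 1" x a]
    by (intro mult_left_mono) (auto simp: algebra_simps)
  finally have "x + (1 - a) * (1 - x + s) \<le> \<gamma> * (1 - a + a * x)" by (simp add: algebra_simps)
  then have "real_ratio a x t \<le> \<gamma>"
    using s assms L_b_pos opt_cost_pos[of x a] a_nonneg a_less_1
    by (simp add: real_ratio_def opt_cost_ge_1 pos_divide_le_eq)
  then show False using bad assms L_b_pos by (simp add: bad_interval_iff)
qed

text \<open>At \<open>L_b + 1\<close> itself later purchases only attain \<open>\<gamma>\<close>. A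
  slightly later stopping time makes them bad, at the price of \<open>e\<close>.\<close>

lemma bad_interval_approximates:
  assumes "0 < e"
  obtains x where "0 < x" "{ennreal (L_b a \<gamma> + e)<..} \<subseteq> bad_interval a \<gamma> (ennreal x)"
proof -
  \<comment> \<open>So small that shifting \<open>x\<close> by \<open>d\<close> moves the threshold
    of bad purchases by at most \<open>e\<close>.\<close>
  define d where "d = (1 - a) * e / \<gamma>"
  define x where "x = L_b a \<gamma> + 1 + d"
  have d: "0 < d" using assms a_less_1 \<gamma>_gt_1 by (simp add: d_def)
  have "(\<gamma> - 1) * a * d \<le> \<gamma> * 1 * d"
    using d a_nonneg a_less_1 \<gamma>_gt_1 by (intro mult_mono) auto
  also have "\<dots> = (1 - a) * e" using \<gamma>_gt_1 by (simp add: d_def)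
  finally have d_le: "(\<gamma> - 1) * a * d \<le> (1 - a) * e" .
  have x: "1 < x" using d L_b_pos by (simp add: x_def)
  have D: "0 < opt_cost a x" "opt_cost a x = 1 - a + a * x"
    using x opt_cost_pos[of x a] a_nonneg a_less_1 by (auto simp: opt_cost_ge_1)
  have "\<gamma> < real_ratio a x t" if t: "ennreal (L_b a \<gamma> + e) < t" for t
  proof -
    have "0 < x" using x by simp
    then show ?thesis
    proof (cases rule: ennreal_le_cases[of x t])
      case (le s)
      then have "L_b a \<gamma> + e < s" using t assms L_b_pos by (simp add: ennreal_less_iff del: ennreal_plus)
      then have "(1 - a) * (L_b a \<gamma> + e) < (1 - a) * s" using a_less_1 by simp
      moreover have "(\<gamma> - 1) * (1 - a + a * x) = (1 - a) * L_b a \<gamma> + (\<gamma> - 1) * a * d"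
        unfolding L_b_identity by (simp add: x_def algebra_simps)
      ultimately have "\<gamma> * (1 - a + a * x) < x + (1 - a) * (1 - x + s)"
        using d_le by (simp add: algebra_simps)
      then show ?thesis using D le by (simp add: real_ratio_def pos_less_divide_eq)
    next
      case gt
      have "\<gamma> * (1 - a) + 0 < (L_b a \<gamma> + 1) * (1 - a * \<gamma>) + d * (1 - a * \<gamma>)"
        using d \<gamma>_less unfolding L_b_plus_1_eq by (intro add_le_less_mono) auto
      then have "\<gamma> * (1 - a + a * x) < x" by (simp add: x_def algebra_simps)
      then show ?thesis using D gt by (simp add: real_ratio_def pos_less_divide_eq)
    qed
  qed
  then have "{ennreal (L_b a \<gamma> + e)<..} \<subseteq> bad_interval a \<gamma> (ennreal x)"
    using x by (simp add: subset_iff bad_interval_iff del: ennreal_plus)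
  then show ?thesis using that x by (meson less_trans zero_less_one)
qed

lemma bad_interval_borel: "0 < x \<Longrightarrow> bad_interval a \<gamma> x \<in> sets borel"
proof (cases "x = \<infinity>")
  case True
  then have "bad_interval a \<gamma> x = {} \<or> bad_interval a \<gamma> x = {\<infinity>}"
    using bad_interval_infinity by auto
  then show ?thesis by auto
next
  case False
  assume "0 < x"
  with False obtain r where r: "x = ennreal r" "0 < r" by (cases x) auto
  have "{t. \<gamma> < real_ratio a r t} \<in> sets borel" by measurable
  moreover have "bad_interval a \<gamma> x = {t. \<gamma> < real_ratio a r t}"
    using r by (auto simp: bad_interval_iff)
  ultimately show ?thesis by simp
qed

text \<open>The tail is an increasing union of sets that lie in bad intervals. Only a tail mass
  below \<open>\<delta>\<close> then remains to be refuted.\<close>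

lemma tail_mass_le:
  assumes "feasible a \<gamma> \<delta> f"
  shows "measure f {ennreal (L_b a \<gamma>)<..} \<le> \<delta>"
proof -
  interpret prob_space f using assms by (simp add: feasible_def purchase_distribution_def)
  have [measurable_cong, simp]: "sets f = sets borel"
    using assms by (simp add: feasible_def purchase_distribution_def)
  let ?A = "\<lambda>n. {ennreal (L_b a \<gamma> + inverse (real (Suc n)))<..}"
  have "prob (?A n) \<le> \<delta>" for n
  proof -
    have "0 < inverse (real (Suc n))" by simp
    then obtain x where x: "0 < x" "?A n \<subseteq> bad_interval a \<gamma> (ennreal x)"
      by (rule bad_interval_approximates)
    then have "prob (?A n) \<le> prob (bad_interval a \<gamma> (ennreal x))"
      using bad_interval_borel[of "ennreal x"] by (intro finite_measure_mono) auto
    also have "\<dots> \<le> \<delta>" using assms x by (simp add: feasible_def)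
    finally show ?thesis .
  qed
  moreover have "(\<lambda>n. prob (?A n)) \<longlonglongrightarrow> prob (\<Union>n. ?A n)"
  proof (rule finite_Lim_measure_incseq)
    show "incseq ?A"
    proof (rule incseq_SucI, rule subsetI)
      fix n t assume "t \<in> ?A n"
      moreover have "ennreal (L_b a \<gamma> + inverse (real (Suc (Suc n))))
          \<le> ennreal (L_b a \<gamma> + inverse (real (Suc n)))"
        by (intro ennreal_leI add_left_mono le_imp_inverse_le) auto
      ultimately show "t \<in> ?A (Suc n)" unfolding greaterThan_iff by (rule le_less_trans[rotated])
    qed
  qed auto
  moreover have "(\<Union>n. ?A n) = {ennreal (L_b a \<gamma>)<..}"
  proof (intro equalityI subsetI)
    fix t assume "t \<in> (\<Union>n. ?A n)"
    then obtain n where "ennreal (L_b a \<gamma> + inverse (real (Suc n))) < t" by auto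
    moreover have "ennreal (L_b a \<gamma>) \<le> ennreal (L_b a \<gamma> + inverse (real (Suc n)))"
      by (intro ennreal_leI) simp
    ultimately show "t \<in> {ennreal (L_b a \<gamma>)<..}"
      unfolding greaterThan_iff by (rule le_less_trans[rotated])
  next
    fix t assume t: "t \<in> {ennreal (L_b a \<gamma>)<..}"
    have "(\<lambda>n. ennreal (L_b a \<gamma> + inverse (real (Suc n)))) \<longlonglongrightarrow> ennreal (L_b a \<gamma> + 0)"
      by (intro tendsto_ennrealI tendsto_add tendsto_const LIMSEQ_inverse_real_of_nat)
    then have "\<forall>\<^sub>F n in sequentially. ennreal (L_b a \<gamma> + inverse (real (Suc n))) < t"
      using t by (intro order_tendstoD(2)) auto
    then show "t \<in> (\<Union>n. ?A n)" by (auto simp only: eventually_sequentially UN_iff greaterThan_iff)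
  qed
  ultimately show ?thesis by (auto intro: LIMSEQ_le_const2)
qed

text \<open>Buying surely at time \<open>1\<close> has ratio at most \<open>2 - a\<close>
  everywhere, hence no bad outcome. The bound makes the optimal value finite, so that it can serve
  as the real number \<open>c\<close>.\<close>

lemma OPT_le:
  assumes "0 \<le> \<delta>"
  shows "OPT a \<gamma> \<delta> \<le> ennreal \<gamma>"
proof -
  have le: "real_ratio a x 1 \<le> \<gamma>" if "0 < x" for x
  proof (cases "x < 1")
    case True
    then have "ennreal x < 1" using ennreal_lessI[of 1 x] by simp
    then show ?thesis using True that \<gamma>_gt_1 a_less_1 by (simp add: real_ratio_def opt_cost_le_1)
  next
    case False
    then have D: "1 \<le> opt_cost a x" "opt_cost a x = 1 - a + a * x"
      using one_le_opt_cost[of x a] a_nonneg a_less_1 by (auto simp: opt_cost_ge_1)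
    have "excess x 1 = 2 - x" using excess_le[of 1 x] False by simp
    moreover have "(\<gamma> - 1) * 1 \<le> (\<gamma> - 1) * opt_cost a x"
      using D \<gamma>_gt_1 by (intro mult_left_mono) auto
    moreover have "x + (1 - a) * (2 - x) = opt_cost a x + (1 - a)"
      unfolding D(2) by (simp add: algebra_simps)
    ultimately have "x + (1 - a) * excess x 1 \<le> \<gamma> * opt_cost a x"
      using \<gamma>_ge by (simp add: left_diff_distrib)
    then show ?thesis using D(1) by (simp add: real_ratio_def pos_divide_le_eq)
  qed
  interpret two_slope a "return borel (1::ennreal)"
    using a_nonneg a_less_1
    by unfold_locales (auto simp: purchase_distribution_def intro: prob_space_return)
  have not_bad: "1 \<notin> bad_interval a \<gamma> x" if "0 < x" for x
    using that le bad_interval_infinity by (cases x) (auto simp: bad_interval_iff not_less)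
  then have "prob (bad_interval a \<gamma> x) \<le> \<delta>" if "0 < x" for x
    using that assms by (simp add: measure_def emeasure_return bad_interval_borel)
  then have "feasible a \<gamma> \<delta> (return borel 1)"
    using purchase_distribution by (simp add: feasible_def)
  moreover have "worst_ratio a (return borel 1) \<le> ennreal \<gamma>"
    using le by (intro worst_ratio_le) (simp add: mean_ratio_eq integral_return)
  ultimately show ?thesis unfolding OPT_def by (auto intro: INF_lower2)
qed

end

theorem theorem12:
  fixes a \<gamma> \<delta> :: real and f :: "ennreal measure"
  assumes "0 \<le> a" and "a < 1"
    and "2 - a \<le> \<gamma>" and "ennreal \<gamma> < 1 / ennreal a"
    and "0 \<le> \<delta>" and "\<delta> \<le> 1"
    and "optimal_solution a \<gamma> \<delta> f"
    and "\<And>T1 T2. zero_interval f T1 T2 \<Longrightarrow> {T1..T2} \<subseteq> {1..<\<infinity>} \<Longrightarrow>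
           strict_antimono_on {T1..T2} (expected_ratio a f)"
  shows "measure f {ennreal (L_b a \<gamma>)<..} = \<delta>"
proof (rule ccontr)
  assume neq: "measure f {ennreal (L_b a \<gamma>)<..} \<noteq> \<delta>"
  have "a * \<gamma> < 1"
  proof (cases "a = 0")
    case False
    then have "ennreal \<gamma> < ennreal (1 / a)"
      using assms(1,4) divide_ennreal[of 1 a] by simp
    then show ?thesis using False assms(1-3) by (simp add: ennreal_less_iff field_simps)
  qed simp
  then interpret tail_constraint a \<gamma>
    using assms by unfold_locales auto
  have feas: "feasible a \<gamma> \<delta> f" and opt: "worst_ratio a f = OPT a \<gamma> \<delta>"
    using assms(7) by (auto simp: optimal_solution_def)
  interpret two_slope a f
    using assms(1,2) feas by unfold_locales (auto simp: feasible_def)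
  obtain c where c: "0 \<le> c" "OPT a \<gamma> \<delta> = ennreal c"
    using OPT_le[OF assms(5)] by (cases "OPT a \<gamma> \<delta>") (auto simp: top_unique)
  interpret steep_solution a f c
  proof unfold_locales
    fix x :: real assume x: "0 < x"
    then have "expected_ratio a f (ennreal x) \<le> ennreal c"
      unfolding c(2)[symmetric] opt[symmetric] worst_ratio_def by (intro SUP_upper) simp
    then show "mean_ratio x \<le> c" using x c(1) by (simp add: expected_ratio_eq)
  next
    fix u v :: real
    assume uv: "1 \<le> u" "u < v" "prob {ennreal u..ennreal v} = 0"
    have antimono: "strict_antimono_on {ennreal u..ennreal v} (expected_ratio a f)"
    proof (rule assms(8))
      show "zero_interval f (ennreal u) (ennreal v)"
        using uv by (simp add: zero_interval_def ennreal_lessI)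
      have "1 \<le> ennreal u" using uv(1) ennreal_leI[of 1 u] by simp
      then have "1 \<le> x \<and> x < \<infinity>" if "ennreal u \<le> x" "x \<le> ennreal v" for x
        using that by (metis infinity_ennreal_def ennreal_less_top le_less_trans order_trans)
      then show "{ennreal u..ennreal v} \<subseteq> {1..<\<infinity>}"
        unfolding subset_iff atLeastAtMost_iff atLeastLessThan_iff by blast
    qed
    have less: "ennreal u < ennreal v" using uv by (intro ennreal_lessI) auto
    have "expected_ratio a f (ennreal v) < expected_ratio a f (ennreal u)"
      using less by (intro monotone_onD[OF antimono _ _ less]) simp_all
    then show "mean_ratio v < mean_ratio u"
      using uv mean_ratio_ge_1[of v] by (simp add: expected_ratio_eq ennreal_less_iff)
  qed
  define \<eta> where "\<eta> = \<delta> - prob {ennreal (L_b a \<gamma>)<..}"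
  have \<eta>: "0 < \<eta>" using neq tail_mass_le[OF feas] by (simp add: \<eta>_def)
  \<comment> \<open>Beyond \<open>L_b + 1\<close> the point \<open>y\<close> is bad only for
    stopping times whose bad interval lies in the tail, and the tail has room for mass
    \<open>\<eta>\<close>.\<close>
  obtain y where y: "L_b a \<gamma> + 1 < y" "1 < y" "improvable_at y"
    by (rule improvable)
  obtain g where g: "purchase_distribution g" "worst_ratio a g < ennreal c"
    and g_le: "\<And>A. A \<in> sets borel \<Longrightarrow> ennreal y \<notin> A \<Longrightarrow> measure g A \<le> prob A"
    and g_le_add: "\<And>A. A \<in> sets borel \<Longrightarrow> measure g A \<le> prob A + \<eta>"
    using improving_displacement[OF y(3,2) \<eta>] by blast
  have "measure g (bad_interval a \<gamma> x) \<le> \<delta>" if x: "0 < x" for x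
  proof (cases "bad_interval a \<gamma> x \<subseteq> {ennreal (L_b a \<gamma>)<..}")
    case True
    have "measure g (bad_interval a \<gamma> x) \<le> prob (bad_interval a \<gamma> x) + \<eta>"
      using x by (intro g_le_add bad_interval_borel)
    also have "\<dots> \<le> prob {ennreal (L_b a \<gamma>)<..} + \<eta>"
      using True by (intro add_right_mono finite_measure_mono) auto
    finally show ?thesis by (simp add: \<eta>_def)
  next
    case False
    then have "x \<noteq> \<infinity>" using bad_interval_infinity by auto
    then obtain r where r: "x = ennreal r" "0 < r" using x by (cases x) auto
    then have "r \<le> L_b a \<gamma> + 1" using False bad_interval_subset by force
    moreover have "ennreal r < ennreal y" using y calculation by (intro ennreal_lessI) auto
    ultimately have "ennreal y \<notin> bad_interval a \<gamma> x"
      using r by (simp add: never_bad_if_late)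
    then have "measure g (bad_interval a \<gamma> x) \<le> prob (bad_interval a \<gamma> x)"
      using x by (intro g_le bad_interval_borel)
    also have "\<dots> \<le> \<delta>" using feas x by (simp add: feasible_def)
    finally show ?thesis .
  qed
  then have "feasible a \<gamma> \<delta> g" using g(1) by (simp add: feasible_def)
  then have "OPT a \<gamma> \<delta> \<le> worst_ratio a g" unfolding OPT_def by (intro INF_lower) simp
  then show False using g(2) c by simp
qed

end
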